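(* For a positive integer $n \equiv 0 \pmod 4$, let $F_1$ and $F_2$ be graphs on a common set of $n$ vertices, both of which are isomorphic to the vertex-disjoint union of $n/4$ copies of the $4$-cycle $C_4$. Then $\gamma_{\rm sd}(F_1,F_2) = n/2$.
   Context: All graphs are finite and simple. Given graphs $F_1, F_2$ (called factors; not necessarily edge-disjoint) with common vertex set $V$, a set $S \subseteq V$ is a simultaneous dominating set if for each $i \in \{1,2\}$ every vertex not in $S$ is adjacent in $F_i$ to some vertex of $S$. The simultaneous domination number $\gamma_{\rm sd}(F_1,F_2)$ is the minimum cardinality of a simultaneous dominating set. *)

theory Defs
  imports "Graph_Theory.Pair_Digraph" "Graph_Theory.Digraph_Isomorphism"
begin

text \<open>
  A finite simple graph is a \<^locale>\<open>pair_graph\<close>: a finite vertex set together with a symmetric,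
  irreflexive arc relation on it, the undirected edge \<open>uv\<close> being the pair of arcs \<open>(u, v)\<close>, \<open>(v, u)\<close>.
  For such graphs \<^const>\<open>digraph_iso\<close> is ordinary graph isomorphism.
\<close>

text \<open>The cycle on \<open>0, \<dots>, k - 1\<close>; only meaningful for \<open>k \<ge> 3\<close>.\<close>

definition cycle_graph :: "nat \<Rightarrow> nat pair_pre_digraph" where
  "cycle_graph k = \<lparr> pverts = {..<k},
     parcs = {(i, j). i < k \<and> j < k \<and> (j = Suc i mod k \<or> i = Suc j mod k)} \<rparr>"

definition disjoint_copies :: "nat \<Rightarrow> 'a pair_pre_digraph \<Rightarrow> (nat \<times> 'a) pair_pre_digraph" where
  "disjoint_copies m G = \<lparr> pverts = {..<m} \<times> pverts G,
     parcs = {((c, u), (c, v)) | c u v. c < m \<and> (u, v) \<in> parcs G} \<rparr>"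

definition dominating_set :: "'a pair_pre_digraph \<Rightarrow> 'a set \<Rightarrow> bool" where
  "dominating_set G S \<longleftrightarrow> S \<subseteq> pverts G \<and> (\<forall>v \<in> pverts G - S. \<exists>u \<in> S. (v, u) \<in> parcs G)"

text \<open>In the following two definitions \<open>F1\<close> and \<open>F2\<close> are meant to have the same vertex set.\<close>

definition simultaneous_dominating_set ::
    "'a pair_pre_digraph \<Rightarrow> 'a pair_pre_digraph \<Rightarrow> 'a set \<Rightarrow> bool" where
  "simultaneous_dominating_set F1 F2 S \<longleftrightarrow> dominating_set F1 S \<and> dominating_set F2 S"

definition sd_number :: "'a pair_pre_digraph \<Rightarrow> 'a pair_pre_digraph \<Rightarrow> nat" where
  "sd_number F1 F2 = (LEAST k. \<exists>S. simultaneous_dominating_set F1 F2 S \<and> card S = k)"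

lemma pair_graph_cycle_graph:
  assumes "k \<ge> 3"
  shows "pair_graph (cycle_graph k)"
proof
  show "finite (parcs (cycle_graph k))"
    by (rule finite_subset[of _ "{..<k} \<times> {..<k}"]) (auto simp: cycle_graph_def)
  show "symmetric (with_proj (cycle_graph k))"
    unfolding symmetric_def sym_def cycle_graph_def with_proj_simps by simp blast
  fix e assume e: "e \<in> parcs (cycle_graph k)"
  then have "fst e < k" "snd e < k" "snd e = Suc (fst e) mod k \<or> fst e = Suc (snd e) mod k"
    by (simp_all add: cycle_graph_def split_beta)
  moreover have "Suc i mod k \<noteq> i" if "i < k" for i
    using that assms by (cases "Suc i = k") simp_all
  ultimately show "fst e \<noteq> snd e"
    by metis
qed (simp_all add: cycle_graph_def split_beta)

lemma pair_graph_disjoint_copies: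
  assumes "pair_graph G"
  shows "pair_graph (disjoint_copies m G)"
proof -
  interpret pair_graph G by fact
  have *: "u \<in> pverts G \<and> v \<in> pverts G \<and> u \<noteq> v \<and> (v, u) \<in> parcs G" if "(u, v) \<in> parcs G" for u v
    using that in_arcsD1 in_arcsD2 pair_no_loops[of "(u, v)"] arcs_ends_symmetric[OF sym_arcs, of u v]
    by simp
  have sub: "parcs (disjoint_copies m G) \<subseteq> ({..<m} \<times> pverts G) \<times> ({..<m} \<times> pverts G)"
    unfolding disjoint_copies_def using * by fastforce
  show ?thesis
  proof
    show "finite (parcs (disjoint_copies m G))"
      by (rule finite_subset[OF sub]) (simp add: pair_finite_verts)
    show "symmetric (with_proj (disjoint_copies m G))"
      unfolding symmetric_def sym_def disjoint_copies_def with_proj_simps using * by simp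
    show "finite (pverts (disjoint_copies m G))"
      by (simp add: disjoint_copies_def pair_finite_verts)
    fix e assume e: "e \<in> parcs (disjoint_copies m G)"
    show "fst e \<in> pverts (disjoint_copies m G)" "snd e \<in> pverts (disjoint_copies m G)"
      using sub e unfolding disjoint_copies_def by fastforce+
    show "fst e \<noteq> snd e"
      using e * unfolding disjoint_copies_def by fastforce
  qed
qed

lemma sd_number_attained:
  assumes "pverts F1 = V" "pverts F2 = V"
  shows "\<exists>S. simultaneous_dominating_set F1 F2 S \<and> card S = sd_number F1 F2"
proof -
  have "simultaneous_dominating_set F1 F2 V"
    using assms by (auto simp: simultaneous_dominating_set_def dominating_set_def)
  then have "\<exists>k S. simultaneous_dominating_set F1 F2 S \<and> card S = k"
    by blast
  then show ?thesis
    unfolding sd_number_def by (rule LeastI_ex)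
qed

end

theory Submission
  imports Defs
begin

text \<open>
  A dominating set meets every 4-cycle in at least two vertices, since a single vertex does not
  dominate the opposite one; hence \<open>n/2\<close> is a lower bound. Conversely, pairing opposite vertices
  gives a perfect matching for each factor. The union of two perfect matchings consists of even
  cycles, so it is properly 2-colourable, and a colour class contains exactly one vertex of each
  opposite pair in both factors. It has \<open>n/2\<close> vertices, and it dominates because the two neighbours
  of a vertex of a 4-cycle are opposite to each other.
\<close>

section \<open>Two perfect matchings and a common transversal\<close>

text \<open>Encodes a perfect matching of \<open>V\<close>, with \<open>x\<close> matched to
  \<open>f x\<close>.\<close>

definition fixpoint_free_involution_on :: "'a set \<Rightarrow> ('a \<Rightarrow> 'a) \<Rightarrow> bool" where
  "fixpoint_free_involution_on V f \<longleftrightarrow> (\<forall>x\<in>V. f x \<in> V \<and> f x \<noteq> x \<and> f (f x) = x)"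

text \<open>Induction on \<open>V\<close>: deleting an \<open>f\<close>-edge and rewiring
  \<open>g\<close> around it shortens the alternating cycle through that edge by two vertices, so no
  cycle has to be traversed. \<open>g\<close> is kept arbitrary because the rewiring changes it,
  whereas \<open>f\<close> merely restricts.\<close>

lemma common_transversal_of_involutions:
  assumes "finite V" "fixpoint_free_involution_on V f" "fixpoint_free_involution_on V g"
  shows "\<exists>S\<subseteq>V. \<forall>x\<in>V. (f x \<in> S \<longleftrightarrow> x \<notin> S) \<and> (g x \<in> S \<longleftrightarrow> x \<notin> S)"
  using assms
proof (induction V arbitrary: g rule: finite_psubset_induct)
  case (psubset V)
  show ?case
  proof (cases "V = {}")
    case True
    then show ?thesis by simp
  next
    case False
    then obtain x where x: "x \<in> V" by blast
    define y where "y = f x"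
    define W where "W = V - {x, y}"
    \<comment> \<open>Remove the edge \<open>xy\<close> and join the two loose ends; if \<open>g x = y\<close> there are none and \<open>h = g\<close> on \<open>W\<close>.\<close>
    define h where "h = g(g x := g y, g y := g x)"
    have f: "f z \<in> V" "f z \<noteq> z" "f (f z) = z" and g: "g z \<in> V" "g z \<noteq> z" "g (g z) = z"
      if "z \<in> V" for z
      using psubset.prems that by (auto simp: fixpoint_free_involution_on_def)
    have y: "y \<in> V" "y \<noteq> x" "f y = x"
      using f[OF x] by (auto simp: y_def)
    have fW: "fixpoint_free_involution_on W f"
      unfolding fixpoint_free_involution_on_def
    proof
      fix z assume "z \<in> W"
      then have z: "z \<in> V" "z \<noteq> x" "z \<noteq> y" by (auto simp: W_def)
      then have "f z \<noteq> x" "f z \<noteq> y" using f(3) x y by (metis y_def)+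
      then show "f z \<in> W \<and> f z \<noteq> z \<and> f (f z) = z" using f z by (simp add: W_def)
    qed
    have gg: "g a = g b \<longleftrightarrow> a = b" if "a \<in> V" "b \<in> V" for a b
      using g that by metis
    have hW: "fixpoint_free_involution_on W h"
      unfolding fixpoint_free_involution_on_def
    proof
      fix z assume z: "z \<in> W"
      show "h z \<in> W \<and> h z \<noteq> z \<and> h (h z) = z"
      \<comment> \<open>Only at these two points can \<open>h\<close> differ from \<open>g\<close>.
        If \<open>g x = y\<close>, they are \<open>y\<close> and \<open>x\<close> themselves, which
        lie outside \<open>W\<close>.\<close>
      proof (cases "z = g x \<or> z = g y")
        case True
        have "g x \<noteq> y"
        proof
          assume "g x = y"
          then have "g y = x" using g(3)[OF x] by simp
          then show False using True z \<open>g x = y\<close> by (auto simp: W_def)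
        qed
        moreover have "g y \<noteq> x" using g(3)[OF y(1)] calculation by auto
        moreover have "g x \<noteq> g y" using gg x y by simp
        ultimately show ?thesis
          using True g[OF x] g[OF y(1)] by (auto simp: h_def W_def)
      next
        case False
        then have "g z \<noteq> x" "g z \<noteq> y" using z g unfolding W_def by auto
        moreover have "g z \<noteq> g x" "g z \<noteq> g y" using z x y gg by (auto simp: W_def)
        ultimately show ?thesis
          using False z g by (auto simp: h_def W_def)
      qed
    qed
    have "W \<subset> V" using x by (auto simp: W_def)
    then obtain S where S: "S \<subseteq> W"
      "\<And>z. z \<in> W \<Longrightarrow> (f z \<in> S \<longleftrightarrow> z \<notin> S) \<and> (h z \<in> S \<longleftrightarrow> z \<notin> S)"
      using psubset.IH[OF _ fW hW] by blast
    \<comment> \<open>\<open>x\<close> is put on the side opposite to \<open>g x\<close>, and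
      \<open>y\<close> on the other. If \<open>g x = y\<close>, then \<open>g x \<notin> S\<close>
      and the default is to add \<open>x\<close>.\<close>
    define T where "T = (if g x \<in> S then insert y S else insert x S)"
    have xyS: "x \<notin> S" "y \<notin> S" using S(1) by (auto simp: W_def)
    have T_xy: "x \<in> T \<longleftrightarrow> g x \<notin> S" "y \<in> T \<longleftrightarrow> g x \<in> S"
      using y xyS by (auto simp: T_def)
    have T_W: "z \<in> T \<longleftrightarrow> z \<in> S" if "z \<in> W" for z
      using that by (auto simp: T_def W_def)
    have fT: "f z \<in> T \<longleftrightarrow> z \<notin> T" if z: "z \<in> V" for z
    proof (cases "z \<in> W")
      case True
      then have "f z \<in> W" using fW
        by (auto simp: fixpoint_free_involution_on_def)
      then show ?thesis using True S(2) T_W by auto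
    next
      case False
      then show ?thesis using z y T_xy y_def by (auto simp: W_def)
    qed
    have gT_x: "g x \<in> T \<longleftrightarrow> x \<notin> T"
      using T_xy T_W[of "g x"] x g y xyS by (cases "g x = y") (auto simp: W_def)
    have gT_y: "g y \<in> T \<longleftrightarrow> y \<notin> T"
    proof (cases "g x = y")
      case True
      then show ?thesis using gT_x x g by auto
    next
      case False
      then have "g y \<noteq> x" using g(3)[OF y(1)] by auto
      then have W: "g x \<in> W" "g y \<in> W" using False g[OF x] g[OF y(1)] by (auto simp: W_def)
      \<comment> \<open>The new edge puts \<open>g x\<close> and \<open>g y\<close> on different
        sides. So do \<open>x\<close> and \<open>y\<close> lie, hence setting \<open>x\<close>
        against \<open>g x\<close> also sets \<open>y\<close> against \<open>g y\<close>.\<close>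
      have "h (g x) = g y" using gg x y by (auto simp: h_def)
      then show ?thesis using S(2)[OF W(1)] T_W[OF W(2)] T_xy by auto
    qed
    have gT: "g z \<in> T \<longleftrightarrow> z \<notin> T" if z: "z \<in> V" for z
    proof -
      consider "z = x" | "z = y" | "z = g x" | "z = g y" | "z \<in> W" "z \<noteq> g x" "z \<noteq> g y"
        using z by (auto simp: W_def)
      then show ?thesis
      proof cases
        case 5
        then have "g z \<in> W" using g[OF z] by (auto simp: W_def)
        moreover have "h z = g z" using 5 by (simp add: h_def)
        ultimately show ?thesis using S(2)[OF 5(1)] T_W 5(1) by auto
      qed (use gT_x gT_y g(3)[OF x] g(3)[OF y(1)] in auto)
    qed
    have "T \<subseteq> V" using S(1) x y by (auto simp: T_def W_def)
    then show ?thesis using fT gT by blast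
  qed
qed

text \<open>Being its own inverse on \<open>V\<close>, \<open>f\<close> exchanges \<open>S\<close>
  and \<open>V - S\<close> bijectively.\<close>

lemma card_transversal_of_involution:
  assumes "finite V" "fixpoint_free_involution_on V f" "S \<subseteq> V"
    and S: "\<And>x. x \<in> V \<Longrightarrow> f x \<in> S \<longleftrightarrow> x \<notin> S"
  shows "2 * card S = card V"
proof -
  have f: "f x \<in> V" "f (f x) = x" if "x \<in> V" for x
    using assms(2) that by (auto simp: fixpoint_free_involution_on_def)
  have "bij_betw f S (V - S)"
    by (rule bij_betw_byWitness[where f' = f]) (use f S assms(3) in auto)
  then have "card S = card (V - S)" by (rule bij_betw_same_card)
  also have "\<dots> = card V - card S"
    using assms by (simp add: card_Diff_subset finite_subset)
  finally show ?thesis using card_mono[OF assms(1,3)] by simp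
qed

section \<open>Isomorphisms as vertex bijections\<close>

text \<open>An isomorphism carries separate maps for vertices and arcs. Here tail and head are the
  pair projections on both sides, so the vertex map determines the arc map; its injectivity reflects
  arcs back.\<close>

lemma digraph_iso_with_projE:
  assumes "digraph_iso (with_proj G) (with_proj H)"
  obtains p where "bij_betw p (pverts G) (pverts H)"
    and "\<And>u v. u \<in> pverts G \<Longrightarrow> v \<in> pverts G \<Longrightarrow> (u, v) \<in> parcs G \<longleftrightarrow> (p u, p v) \<in> parcs H"
proof -
  from assms obtain q where q: "pre_digraph.digraph_isomorphism (with_proj G) q"
    and H: "with_proj H = app_iso q (with_proj G)"
    by (auto simp: digraph_iso_def)
  let ?p = "iso_verts q"
  have verts: "pverts H = ?p ` pverts G" and arcs: "parcs H = iso_arcs q ` parcs G"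
    and proj: "iso_tail q = fst" "iso_head q = snd"
    using arg_cong[OF H, of verts] arg_cong[OF H, of arcs]
      arg_cong[OF H, of tail] arg_cong[OF H, of head] by simp_all
  have wf: "pair_wf_digraph G" and inj: "inj_on ?p (pverts G)"
    and iso: "\<And>e. e \<in> parcs G \<Longrightarrow> iso_arcs q e = (?p (fst e), ?p (snd e))"
    using q by (auto simp: pre_digraph.digraph_isomorphism_def proj wf_digraph_wp_iff prod_eq_iff)
  interpret pair_wf_digraph G by fact
  show ?thesis
  proof (rule that)
    show "bij_betw ?p (pverts G) (pverts H)"
      using inj verts by (simp add: bij_betw_def)
    fix u v assume uv: "u \<in> pverts G" "v \<in> pverts G"
    show "(u, v) \<in> parcs G \<longleftrightarrow> (?p u, ?p v) \<in> parcs H"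
    proof
      assume "(u, v) \<in> parcs G"
      then show "(?p u, ?p v) \<in> parcs H" using iso[of "(u, v)"] arcs by force
    next
      assume "(?p u, ?p v) \<in> parcs H"
      then obtain a b where ab: "(a, b) \<in> parcs G" "?p a = ?p u" "?p b = ?p v"
        using iso arcs by fastforce
      then show "(u, v) \<in> parcs G"
        using uv inj in_arcsD1[OF ab(1)] in_arcsD2[OF ab(1)] by (metis inj_onD)
    qed
  qed
qed

section \<open>Copies of the 4-cycle and the lower bound\<close>

text \<open>The 4-cycle is the complete bipartite graph between even and odd vertices, so parity can
  replace successors modulo 4.\<close>

lemma parcs_cycle_graph_4:
  "(i, j) \<in> parcs (cycle_graph 4) \<longleftrightarrow> i < 4 \<and> j < 4 \<and> odd (i + j)"
proof -
  have "j = Suc i mod 4 \<or> i = Suc j mod 4 \<longleftrightarrow> odd (i + j)" if "i < 4" "j < 4"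
  proof -
    have "i = 0 \<or> i = 1 \<or> i = 2 \<or> i = 3" "j = 0 \<or> j = 1 \<or> j = 2 \<or> j = 3"
      using that by linarith+
    then show ?thesis
      by (elim disjE) (simp_all del: One_nat_def)
  qed
  then show ?thesis
    unfolding cycle_graph_def pair_pre_digraph.simps mem_Collect_eq prod.case by blast
qed

lemma parcs_copies_cycle_graph_4:
  "((c, i), (d, j)) \<in> parcs (disjoint_copies m (cycle_graph 4)) \<longleftrightarrow>
     c = d \<and> c < m \<and> i < 4 \<and> j < 4 \<and> odd (i + j)"
  by (auto simp: disjoint_copies_def parcs_cycle_graph_4)

lemma pverts_copies_cycle_graph_4:
  "pverts (disjoint_copies m (cycle_graph 4)) = {..<m} \<times> {..<4}"
  by (simp add: disjoint_copies_def cycle_graph_def)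

lemma dominating_set_iso:
  assumes p: "bij_betw p (pverts G) (pverts H)"
    and arc: "\<And>u v. u \<in> pverts G \<Longrightarrow> v \<in> pverts G \<Longrightarrow> (u, v) \<in> parcs G \<longleftrightarrow> (p u, p v) \<in> parcs H"
    and S: "dominating_set G S"
  shows "dominating_set H (p ` S)"
  unfolding dominating_set_def
proof (intro conjI ballI)
  have SV: "S \<subseteq> pverts G" using S by (simp add: dominating_set_def)
  then show "p ` S \<subseteq> pverts H" using p by (auto simp: bij_betw_def)
  fix w assume "w \<in> pverts H - p ` S"
  then obtain v where v: "v \<in> pverts G - S" "w = p v" using p unfolding bij_betw_def by blast
  then obtain u where "u \<in> S" "(v, u) \<in> parcs G" using S by (auto simp: dominating_set_def)
  then show "\<exists>u\<in>p ` S. (w, u) \<in> parcs H" using v SV arc by blast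
qed

lemma card_dominating_set_copies_cycle_graph_4:
  assumes "dominating_set (disjoint_copies m (cycle_graph 4)) S"
  shows "2 * m \<le> card S"
proof -
  define B where "B c = {i. (c, i) \<in> S}" for c
  have S: "S \<subseteq> {..<m} \<times> {..<4}"
    using assms by (simp add: dominating_set_def pverts_copies_cycle_graph_4)
  have dom: "\<exists>j\<in>B c. odd (i + j)" if "c < m" "i < 4" "i \<notin> B c" for c i
  proof -
    have "(c, i) \<in> {..<m} \<times> {..<4} - S" using that by (simp add: B_def)
    then obtain d j where "(d, j) \<in> S" "((c, i), (d, j)) \<in> parcs (disjoint_copies m (cycle_graph 4))"
      using assms unfolding dominating_set_def pverts_copies_cycle_graph_4 by (metis surj_pair)
    then show ?thesis unfolding parcs_copies_cycle_graph_4 B_def by blast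
  qed
  have fin: "finite (B c)" for c
    by (rule finite_subset[of _ "{..<4}"]) (use S in \<open>auto simp: B_def\<close>)
  have "2 \<le> card (B c)" if c: "c < m" for c
  proof (rule ccontr)
    assume "\<not> 2 \<le> card (B c)"
    then have "card (B c) \<le> Suc 0" by simp
    then have eq: "i = j" if "i \<in> B c" "j \<in> B c" for i j
      using that fin[of c] by (auto simp: card_le_Suc0_iff_eq)
    \<comment> \<open>An empty slice would leave vertex 0 of the copy undominated.\<close>
    obtain a where a: "a \<in> B c" using dom[OF c, of 0] by auto
    \<comment> \<open>The vertex opposite to \<open>a\<close>. It has the parity of
      \<open>a\<close>, so \<open>a\<close> does not dominate it, and the slice has no other
      element.\<close>
    define b where "b = (if a < 2 then a + 2 else a - 2)"
    have "a < 4" using a S by (auto simp: B_def)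
    then have b: "b < 4" "b \<noteq> a" "even (b + a)" by (auto simp: b_def)
    then have "b \<notin> B c" using eq[OF a] by blast
    then show False using dom[OF c b(1)] eq[OF a] b(3) by blast
  qed
  then have "(\<Sum>c<m. 2) \<le> (\<Sum>c<m. card (B c))" by (intro sum_mono) simp
  also have "\<dots> = card (SIGMA c:{..<m}. B c)" using fin by simp
  also have "(SIGMA c:{..<m}. B c) = S" using S by (auto simp: B_def)
  finally show ?thesis by (simp add: mult.commute)
qed

lemma card_dominating_set_iso_copies_cycle_graph_4:
  assumes "digraph_iso (with_proj G) (with_proj (disjoint_copies m (cycle_graph 4)))"
    and S: "dominating_set G S"
  shows "2 * m \<le> card S"
proof -
  obtain p where p: "bij_betw p (pverts G) (pverts (disjoint_copies m (cycle_graph 4)))"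
    and arc: "\<And>u v. u \<in> pverts G \<Longrightarrow> v \<in> pverts G \<Longrightarrow>
      (u, v) \<in> parcs G \<longleftrightarrow> (p u, p v) \<in> parcs (disjoint_copies m (cycle_graph 4))"
    using digraph_iso_with_projE[OF assms(1)] by metis
  have "inj_on p S"
    using p S by (auto simp: bij_betw_def dominating_set_def dest: inj_on_subset)
  then have "card (p ` S) = card S" by (rule card_image)
  with card_dominating_set_copies_cycle_graph_4[OF dominating_set_iso[OF p arc S]]
  show ?thesis by simp
qed

section \<open>Opposite vertices and the upper bound\<close>

text \<open>On each 4-cycle this is the antipodal map, adding 2 modulo 4.\<close>

definition opposite :: "nat \<times> nat \<Rightarrow> nat \<times> nat" where
  "opposite = (\<lambda>(c, i). (c, if i < 2 then i + 2 else i - 2))"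

text \<open>\<open>f\<close> is the antipodal map pulled back along the isomorphism. The second
  property keeps all that domination needs: some matched pair consists of neighbours of
  \<open>v\<close>.\<close>

lemma iso_copies_cycle_graph_4_opposite:
  assumes "digraph_iso (with_proj G) (with_proj (disjoint_copies m (cycle_graph 4)))"
  obtains f where "fixpoint_free_involution_on (pverts G) f"
    and "\<And>v. v \<in> pverts G \<Longrightarrow> \<exists>u\<in>pverts G. (v, u) \<in> parcs G \<and> (v, f u) \<in> parcs G"
proof -
  let ?H = "disjoint_copies m (cycle_graph 4)"
  obtain p where p: "bij_betw p (pverts G) (pverts ?H)"
    and arc: "\<And>u v. u \<in> pverts G \<Longrightarrow> v \<in> pverts G \<Longrightarrow> (u, v) \<in> parcs G \<longleftrightarrow> (p u, p v) \<in> parcs ?H"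
    using digraph_iso_with_projE[OF assms] by metis
  define q where "q = inv_into (pverts G) p"
  define f where "f = q \<circ> opposite \<circ> p"
  have pH: "p v \<in> pverts ?H" "q (p v) = v" if "v \<in> pverts G" for v
    using p that by (auto simp: q_def bij_betw_def)
  have qG: "q w \<in> pverts G" "p (q w) = w" if "w \<in> pverts ?H" for w
    using p that by (auto simp: q_def bij_betw_def inv_into_into f_inv_into_f)
  have opp: "opposite w \<in> pverts ?H" "opposite w \<noteq> w" "opposite (opposite w) = w"
    if "w \<in> pverts ?H" for w
    using that by (auto simp: opposite_def pverts_copies_cycle_graph_4 split: if_splits)
  show ?thesis
  proof (rule that)
    show "fixpoint_free_involution_on (pverts G) f"
      unfolding fixpoint_free_involution_on_def f_def comp_def
      using pH qG opp by metis
    fix v assume v: "v \<in> pverts G"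
    obtain c i where ci: "p v = (c, i)" "c < m" "i < 4"
      using pH(1)[OF v] by (auto simp: pverts_copies_cycle_graph_4)
    \<comment> \<open>A vertex of the other parity in the same copy; it and its opposite are the two
      neighbours of \<open>p v\<close>.\<close>
    define w where "w = (c, 1 - i mod 2)"
    have w: "w \<in> pverts ?H" using ci by (simp add: w_def pverts_copies_cycle_graph_4)
    have "(p v, w) \<in> parcs ?H" "(p v, opposite w) \<in> parcs ?H"
      using ci by (cases "even i"; simp add: w_def opposite_def parcs_copies_cycle_graph_4
        odd_iff_mod_2_eq_one)+
    then show "\<exists>u\<in>pverts G. (v, u) \<in> parcs G \<and> (v, f u) \<in> parcs G"
      using v w qG opp(1) arc by (intro bexI[of _ "q w"]) (auto simp: f_def)
  qed
qed

text \<open>Of the neighbours \<open>u\<close> and \<open>f u\<close> of \<open>v\<close>, exactly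
  one lies in \<open>S\<close>, and it dominates \<open>v\<close>.\<close>

lemma dominating_set_transversal_opposite:
  assumes "S \<subseteq> pverts G" and S: "\<And>x. x \<in> pverts G \<Longrightarrow> f x \<in> S \<longleftrightarrow> x \<notin> S"
    and "\<And>v. v \<in> pverts G \<Longrightarrow> \<exists>u\<in>pverts G. (v, u) \<in> parcs G \<and> (v, f u) \<in> parcs G"
  shows "dominating_set G S"
  unfolding dominating_set_def
proof (intro conjI ballI)
  fix v assume "v \<in> pverts G - S"
  then obtain u where "u \<in> pverts G" "(v, u) \<in> parcs G" "(v, f u) \<in> parcs G"
    using assms(3) by blast
  then show "\<exists>u\<in>S. (v, u) \<in> parcs G" using S by blast
qed fact

theorem theorem24:
  fixes F1 F2 :: "'a pair_pre_digraph" and V :: "'a set" and n :: nat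
  assumes "n > 0" and "n mod 4 = 0"
    and "pair_graph F1" and "pair_graph F2"
    and "pverts F1 = V" and "pverts F2 = V" and "card V = n"
    and "digraph_iso (with_proj F1) (with_proj (disjoint_copies (n div 4) (cycle_graph 4)))"
    and "digraph_iso (with_proj F2) (with_proj (disjoint_copies (n div 4) (cycle_graph 4)))"
  shows "sd_number F1 F2 = n div 2"
proof -
  \<comment> \<open>An infinite set would have cardinality 0, which \<open>n > 0\<close>
    excludes.\<close>
  have V: "finite V" using assms(1,7) card_gt_0_iff by blast
  obtain f where f: "fixpoint_free_involution_on V f"
      "\<And>v. v \<in> V \<Longrightarrow> \<exists>u\<in>V. (v, u) \<in> parcs F1 \<and> (v, f u) \<in> parcs F1"
    using iso_copies_cycle_graph_4_opposite[OF assms(8)] unfolding assms(5) by metis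
  obtain g where g: "fixpoint_free_involution_on V g"
      "\<And>v. v \<in> V \<Longrightarrow> \<exists>u\<in>V. (v, u) \<in> parcs F2 \<and> (v, g u) \<in> parcs F2"
    using iso_copies_cycle_graph_4_opposite[OF assms(9)] unfolding assms(6) by metis
  obtain S where S: "S \<subseteq> V" "\<And>x. x \<in> V \<Longrightarrow> f x \<in> S \<longleftrightarrow> x \<notin> S"
      "\<And>x. x \<in> V \<Longrightarrow> g x \<in> S \<longleftrightarrow> x \<notin> S"
    using common_transversal_of_involutions[OF V f(1) g(1)] by blast
  have "dominating_set F1 S"
    by (rule dominating_set_transversal_opposite[where f = f]) (use S f(2) assms(5) in auto)
  moreover have "dominating_set F2 S"
    by (rule dominating_set_transversal_opposite[where f = g]) (use S g(2) assms(6) in auto)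
  moreover have "card S = n div 2"
    using card_transversal_of_involution[OF V f(1) S(1,2)] assms(7) by simp
  ultimately have attained: "\<exists>S. simultaneous_dominating_set F1 F2 S \<and> card S = n div 2"
    unfolding simultaneous_dominating_set_def by blast
  have "n div 2 \<le> card T" if "simultaneous_dominating_set F1 F2 T" for T
  proof -
    \<comment> \<open>Divisibility by 4 makes two vertices per copy add up to exactly half of all
      vertices; dominating \<open>F1\<close> already forces that many.\<close>
    have "n div 2 = 2 * (n div 4)" using assms(2) by auto
    also have "\<dots> \<le> card T"
      using that card_dominating_set_iso_copies_cycle_graph_4[OF assms(8)]
      by (simp add: simultaneous_dominating_set_def)
    finally show ?thesis .
  qed
  then show ?thesis
    unfolding sd_number_def using attained by (intro Least_equality) auto
qed

end
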